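(* Let $\mathbf A\in\mathbb R^{M\times K}$ and $\mathbf B\in\mathbb R^{K\times N}$ be matrices with no zero rows and no zero columns, let $\mathbf C=\mathbf A\cdot\mathbf B$, and let $t$ be the number of steps of the repeated outside-inside scaling algorithm that are completed before multiplying. Then the computed product $\hat{\mathbf C}$ satisfies, for all $i,j$, $$|c_{ij}-\hat c_{ij}|\le O(\epsilon)\; r_i^{(t)}s_j^{(t)}\;\|\mathbf A^{(t)}\|\,\|\mathbf B^{(t)}\|.$$
   Context: $\|\cdot\|$ is the max-norm, $\|\mathbf X\|=\max_{i,j}|x_{ij}|$, and $\epsilon$ is the machine precision. Repeated outside-inside scaling: set $\mathbf A^{(0)}=\mathbf A$, $\mathbf B^{(0)}=\mathbf B$, $r_i^{(0)}=1$, $s_j^{(0)}=1$. Steps $1,2,\dots$ alternate between O (outside) steps and I (inside) steps; either type may come first. If step $t$ is an O step: let $r_i^{\prime(t)}=\max_k|a^{(t-1)}_{ik}|$ and $s_j^{\prime(t)}=\max_k|b^{(t-1)}_{kj}|$, and set $a^{(t)}_{ik}=a^{(t-1)}_{ik}/r_i^{\prime(t)}$, $b^{(t)}_{kj}=b^{(t-1)}_{kj}/s_j^{\prime(t)}$, $r_i^{(t)}=r_i^{(t-1)}r_i^{\prime(t)}$, $s_j^{(t)}=s_j^{(t-1)}s_j^{\prime(t)}$. If step $t$ is an I step: let $p_k^{\prime(t)}=\sqrt{\max_j|b^{(t-1)}_{kj}|\,/\,\max_i|a^{(t-1)}_{ik}|}$, and set $a^{(t)}_{ik}=a^{(t-1)}_{ik}p_k^{\prime(t)}$,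 $b^{(t)}_{kj}=b^{(t-1)}_{kj}/p_k^{\prime(t)}$, $r_i^{(t)}=r_i^{(t-1)}$, $s_j^{(t)}=s_j^{(t-1)}$. After $t$ completed steps, the product $\mathbf C'=\mathbf A^{(t)}\cdot\mathbf B^{(t)}$ is computed with fast matrix multiplication, and the output is $\mathbf C=\operatorname{diag}(r_i^{(t)})\,\mathbf C'\,\operatorname{diag}(s_j^{(t)})$. It is assumed that there is no numerical error in computing or applying the scaling matrices. "Fast matrix multiplication" means any fixed algorithm that, for input matrices $\mathbf X$ ($M\times K$) and $\mathbf Y$ ($K\times N$) with product $\mathbf Z=\mathbf X\mathbf Y$, returns $\hat{\mathbf Z}$ satisfying $|z_{ij}-\hat z_{ij}|\le f_{\mathrm{alg}}(K)\|\mathbf X\|\|\mathbf Y\|\epsilon+O(\epsilon^2)$ for all $i,j$, where $f_{\mathrm{alg}}$ depends only on the algorithm. In this statement $f_{\mathrm{alg}}$ is treated as a fixed quantity, so that this guarantee reads $|z_{ij}-\hat z_{ij}|\le O(\epsilon)\,\|\mathbf X\|\,\|\mathbf Y\|$; here and in the conclusion, $O(\epsilon)$ denotes a quantity bounded by $\epsilon$ times a constant depending only on the algorithm and the dimensions, not on the entries of the matrices. *)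

theory Defs
  imports "HOL-Analysis.Analysis"
begin

definition max_norm :: "real^'k^'m \<Rightarrow> real" where
  "max_norm X = Max {\<bar>X $ i $ j\<bar> | i j. True}"

definition diag_matrix :: "real^'m \<Rightarrow> real^'m^'m" where
  "diag_matrix v = (\<chi> i j. if i = j then v $ i else 0)"

definition no_zero_rows_columns :: "real^'k^'m \<Rightarrow> bool" where
  "no_zero_rows_columns X \<longleftrightarrow> (\<forall>i. row i X \<noteq> 0) \<and> (\<forall>j. column j X \<noteq> 0)"

text \<open>The matrices and accumulated outside scaling factors after some number of steps.\<close>

record ('m, 'k, 'n) scaling_state =
  matA :: "real^'k^'m"
  matB :: "real^'n^'k"
  rscale :: "real^'m"
  sscale :: "real^'n"

definition outside_step ::
  "('m::finite, 'k::finite, 'n::finite) scaling_state \<Rightarrow> ('m, 'k, 'n) scaling_state" where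
  "outside_step S =
    (let r' = (\<lambda>i. MAX k. \<bar>matA S $ i $ k\<bar>);
         s' = (\<lambda>j. MAX k. \<bar>matB S $ k $ j\<bar>)
     in \<lparr> matA = (\<chi> i k. matA S $ i $ k / r' i),
          matB = (\<chi> k j. matB S $ k $ j / s' j),
          rscale = (\<chi> i. rscale S $ i * r' i),
          sscale = (\<chi> j. sscale S $ j * s' j) \<rparr>)"

definition inside_step ::
  "('m::finite, 'k::finite, 'n::finite) scaling_state \<Rightarrow> ('m, 'k, 'n) scaling_state" where
  "inside_step S =
    (let p' = (\<lambda>k. sqrt ((MAX j. \<bar>matB S $ k $ j\<bar>) / (MAX i. \<bar>matA S $ i $ k\<bar>)))
     in \<lparr> matA = (\<chi> i k. matA S $ i $ k * p' k),
          matB = (\<chi> k j. matB S $ k $ j / p' k),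
          rscale = rscale S,
          sscale = sscale S \<rparr>)"

text \<open>The flag says whether step 1 is an outside step. Step \<open>Suc t\<close> has the type of step 1
  iff \<open>t\<close> is even.\<close>

primrec outside_inside ::
  "bool \<Rightarrow> real^'k^'m \<Rightarrow> real^'n^'k \<Rightarrow> nat \<Rightarrow> ('m::finite, 'k::finite, 'n::finite) scaling_state"
where
  "outside_inside outside_first A B 0 = \<lparr> matA = A, matB = B, rscale = 1, sscale = 1 \<rparr>"
| "outside_inside outside_first A B (Suc t) =
    (if even t = outside_first
     then outside_step (outside_inside outside_first A B t)
     else inside_step (outside_inside outside_first A B t))"

text \<open>The product computed from a scaled state when \<open>mul\<close> is used to multiply
  the scaled matrices; the scaling itself is exact.\<close>

definition scaled_product ::
  "(real^'k^'m \<Rightarrow> real^'n^'k \<Rightarrow> real^'n^'m) \<Rightarrow>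
    ('m::finite, 'k::finite, 'n::finite) scaling_state \<Rightarrow> real^'n^'m" where
  "scaled_product mul S =
    diag_matrix (rscale S) ** mul (matA S) (matB S) ** diag_matrix (sscale S)"

text \<open>\<open>mul \<epsilon> X Y\<close> is the product returned by the algorithm when run with machine
  precision \<open>\<epsilon>\<close>, and \<open>\<epsilon>\<^sub>0\<close> is the coarsest precision considered. The constant behind
  \<open>O(\<epsilon>)\<close> may depend on \<open>mul\<close> and on the dimensions (the index types), but is uniform
  in \<open>\<epsilon>\<close> and in the entries of the matrices.\<close>

definition fast_matrix_mult ::
  "real \<Rightarrow> (real \<Rightarrow> real^'k^'m \<Rightarrow> real^'n^'k \<Rightarrow> real^'n^'m) \<Rightarrow> bool" where
  "fast_matrix_mult \<epsilon>\<^sub>0 mul \<longleftrightarrow>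
    (\<exists>c. \<forall>\<epsilon>\<in>{0<..\<epsilon>\<^sub>0}. \<forall>X Y i j.
      \<bar>(X ** Y) $ i $ j - mul \<epsilon> X Y $ i $ j\<bar> \<le> c * \<epsilon> * max_norm X * max_norm Y)"

end

theory Submission
  imports Defs
begin

text \<open>Every step rescales rows, columns or the inner index by nonzero factors. Hence zero-freeness of
  rows and columns is preserved, so all later factors are again positive, and
  \<open>diag r ** A\<^sub>t ** B\<^sub>t ** diag s\<close> always equals \<open>A ** B\<close> exactly. The error of the output is then the
  error of the fast product of the scaled matrices, multiplied by \<open>r\<^sub>i s\<^sub>j\<close>.\<close>

lemma no_zero_rows_columns_iff:
  "no_zero_rows_columns X \<longleftrightarrow> (\<forall>i. \<exists>j. X $ i $ j \<noteq> 0) \<and> (\<forall>j. \<exists>i. X $ i $ j \<noteq> 0)"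
  by (simp add: no_zero_rows_columns_def row_def column_def vec_eq_iff)

text \<open>The factor \<open>f i j\<close> may depend on both indices, so that one lemma covers
  row, column and inner scaling; divisions enter as multiplication by a reciprocal.\<close>

lemma no_zero_rows_columns_scale:
  assumes "no_zero_rows_columns X" "\<And>i j. Y $ i $ j = X $ i $ j * f i j" "\<And>i j. f i j \<noteq> 0"
  shows "no_zero_rows_columns Y"
  using assms by (simp add: no_zero_rows_columns_iff)

lemma Max_abs_pos:
  fixes f :: "'a::finite \<Rightarrow> real"
  assumes "f k \<noteq> 0"
  shows "0 < (MAX k. \<bar>f k\<bar>)"
  using assms by (auto simp: Max_gr_iff)

lemma row_max_pos:
  assumes "no_zero_rows_columns X"
  shows "0 < (MAX j. \<bar>X $ i $ j\<bar>)"
proof -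
  obtain j where "X $ i $ j \<noteq> 0"
    using assms unfolding no_zero_rows_columns_iff by blast
  then show ?thesis by (rule Max_abs_pos)
qed

lemma column_max_pos:
  assumes "no_zero_rows_columns X"
  shows "0 < (MAX i. \<bar>X $ i $ j\<bar>)"
proof -
  obtain i where "X $ i $ j \<noteq> 0"
    using assms unfolding no_zero_rows_columns_iff by blast
  \<comment> \<open>Here the entry must be read as a function of its row index, with the column
    fixed.\<close>
  then show ?thesis by (rule Max_abs_pos[of "\<lambda>i. X $ i $ j"])
qed

lemma diag_matrix_mult_nth: "(diag_matrix v ** X) $ i $ j = v $ i * X $ i $ j"
  by (simp add: matrix_matrix_mult_def diag_matrix_def if_distrib[of "\<lambda>x. x * _"] cong: if_cong)

lemma mult_diag_matrix_nth: "(X ** diag_matrix v) $ i $ j = X $ i $ j * v $ j"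
  by (simp add: matrix_matrix_mult_def diag_matrix_def if_distrib[of "\<lambda>x. _ * x"] cong: if_cong)

text \<open>The invariant of the iteration, relative to the original \<open>A\<close> and
  \<open>B\<close>. Zero-freeness keeps the divisors of the next step positive; positive
  \<open>rscale\<close> and \<open>sscale\<close> can later be pulled out of absolute
  values.\<close>

definition exact_scaling ::
  "real^'k^'m \<Rightarrow> real^'n^'k \<Rightarrow> ('m::finite, 'k::finite, 'n::finite) scaling_state \<Rightarrow> bool" where
  "exact_scaling A B S \<longleftrightarrow>
    no_zero_rows_columns (matA S) \<and> no_zero_rows_columns (matB S) \<and>
    (\<forall>i. 0 < rscale S $ i) \<and> (\<forall>j. 0 < sscale S $ j) \<and>
    (\<forall>i j. rscale S $ i * (matA S ** matB S) $ i $ j * sscale S $ j = (A ** B) $ i $ j)"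

text \<open>Entry \<open>(i, j)\<close> of the product loses the factor \<open>r i * s j\<close>,
  which the accumulated scales gain.\<close>

lemma exact_scaling_outside_step:
  assumes "exact_scaling A B S"
  shows "exact_scaling A B (outside_step S)"
proof -
  define r where "r i = (MAX k. \<bar>matA S $ i $ k\<bar>)" for i
  define s where "s j = (MAX k. \<bar>matB S $ k $ j\<bar>)" for j
  have nz: "no_zero_rows_columns (matA S)" "no_zero_rows_columns (matB S)"
    and inv: "\<And>i. 0 < rscale S $ i" "\<And>j. 0 < sscale S $ j"
      "\<And>i j. rscale S $ i * (matA S ** matB S) $ i $ j * sscale S $ j = (A ** B) $ i $ j"
    using assms by (auto simp: exact_scaling_def)
  have r: "0 < r i" and s: "0 < s j" for i j
    unfolding r_def s_def using nz by (auto intro: row_max_pos column_max_pos)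
  have r0: "r i \<noteq> 0" and s0: "s j \<noteq> 0" for i j
    using r[of i] s[of j] by auto
  have step: "outside_step S =
    \<lparr> matA = (\<chi> i k. matA S $ i $ k / r i), matB = (\<chi> k j. matB S $ k $ j / s j),
      rscale = (\<chi> i. rscale S $ i * r i), sscale = (\<chi> j. sscale S $ j * s j) \<rparr>"
    by (simp add: outside_step_def r_def s_def Let_def)
  \<comment> \<open>Neither \<open>r i\<close> nor \<open>s j\<close> depends on the summation
    index, so both leave the inner sum.\<close>
  have prod: "(matA (outside_step S) ** matB (outside_step S)) $ i $ j =
      (matA S ** matB S) $ i $ j / (r i * s j)" for i j
    by (simp add: step matrix_matrix_mult_def sum_divide_distrib)
  have nzA: "no_zero_rows_columns (matA (outside_step S))"
    by (rule no_zero_rows_columns_scale[OF nz(1), where f = "\<lambda>i k. 1 / r i"]) (simp_all add: step r0)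
  have nzB: "no_zero_rows_columns (matB (outside_step S))"
    by (rule no_zero_rows_columns_scale[OF nz(2), where f = "\<lambda>k j. 1 / s j"]) (simp_all add: step s0)
  have "rscale (outside_step S) $ i * (matA (outside_step S) ** matB (outside_step S)) $ i $ j *
      sscale (outside_step S) $ j = (A ** B) $ i $ j" for i j
    unfolding prod using inv(3)[of i j] r0[of i] s0[of j] by (simp add: step)
  with nzA nzB inv r s show ?thesis
    by (simp add: exact_scaling_def step)
qed

text \<open>In the \<open>k\<close>-th summand of each product entry, \<open>p k\<close> from the
  left matrix cancels against its reciprocal from the right one, so the product is
  unchanged.\<close>

lemma exact_scaling_inside_step:
  assumes "exact_scaling A B S"
  shows "exact_scaling A B (inside_step S)"
proof -
  define p where "p k = sqrt ((MAX j. \<bar>matB S $ k $ j\<bar>) / (MAX i. \<bar>matA S $ i $ k\<bar>))" for k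
  have nz: "no_zero_rows_columns (matA S)" "no_zero_rows_columns (matB S)"
    using assms by (auto simp: exact_scaling_def)
  have "0 < p k" for k
    \<comment> \<open>Under the root stands a row maximum of \<open>matB S\<close> over a column
      maximum of \<open>matA S\<close>, both positive.\<close>
    unfolding p_def using row_max_pos[OF nz(2)] column_max_pos[OF nz(1)] by simp
  then have p0: "p k \<noteq> 0" for k
    by (metis less_irrefl)
  have step: "inside_step S =
    \<lparr> matA = (\<chi> i k. matA S $ i $ k * p k), matB = (\<chi> k j. matB S $ k $ j / p k),
      rscale = rscale S, sscale = sscale S \<rparr>"
    by (simp add: inside_step_def p_def Let_def)
  have prod: "matA (inside_step S) ** matB (inside_step S) = matA S ** matB S"
    by (simp add: step matrix_matrix_mult_def p0)
  have nzA: "no_zero_rows_columns (matA (inside_step S))"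
    by (rule no_zero_rows_columns_scale[OF nz(1), where f = "\<lambda>i k. p k"]) (simp_all add: step p0)
  have nzB: "no_zero_rows_columns (matB (inside_step S))"
    by (rule no_zero_rows_columns_scale[OF nz(2), where f = "\<lambda>k j. 1 / p k"]) (simp_all add: step p0)
  have "rscale (inside_step S) = rscale S" "sscale (inside_step S) = sscale S"
    by (simp_all add: step)
  with nzA nzB assms show ?thesis
    by (simp add: exact_scaling_def prod)
qed

lemma exact_scaling_outside_inside:
  assumes "no_zero_rows_columns A" "no_zero_rows_columns B"
  shows "exact_scaling A B (outside_inside outside_first A B t)"
proof (induction t)
  case 0
  then show ?case using assms by (simp add: exact_scaling_def)
next
  case (Suc t)
  then show ?case
    by (simp add: exact_scaling_outside_step exact_scaling_inside_step)
qed

text \<open>By the invariant, the exact and the computed product carry the same outer factors, so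
  their difference is the inner error times a positive number.\<close>

lemma scaled_product_error:
  assumes "exact_scaling A B S"
    and "\<bar>(matA S ** matB S) $ i $ j - mul (matA S) (matB S) $ i $ j\<bar> \<le> e"
  shows "\<bar>(A ** B) $ i $ j - scaled_product mul S $ i $ j\<bar> \<le> rscale S $ i * sscale S $ j * e"
proof -
  have pos: "0 < rscale S $ i" "0 < sscale S $ j"
    and exact: "rscale S $ i * (matA S ** matB S) $ i $ j * sscale S $ j = (A ** B) $ i $ j"
    using assms(1) by (auto simp: exact_scaling_def)
  have "(A ** B) $ i $ j - scaled_product mul S $ i $ j =
      rscale S $ i * sscale S $ j *
        ((matA S ** matB S) $ i $ j - mul (matA S) (matB S) $ i $ j)"
    by (simp add: exact[symmetric] scaled_product_def diag_matrix_mult_nth mult_diag_matrix_nth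
        algebra_simps)
  then show ?thesis
    using pos assms(2) by (simp add: abs_mult)
qed

theorem proposition6p5:
  fixes mul :: "real \<Rightarrow> real^'k^'m \<Rightarrow> real^'n^'k \<Rightarrow> real^'n^'m"
    and \<epsilon>\<^sub>0 :: real
  assumes "fast_matrix_mult \<epsilon>\<^sub>0 mul"
  shows "\<exists>c. \<forall>\<epsilon>\<in>{0<..\<epsilon>\<^sub>0}. \<forall>(A :: real^'k^'m) (B :: real^'n^'k) outside_first t.
    no_zero_rows_columns A \<longrightarrow> no_zero_rows_columns B \<longrightarrow>
    (let S = outside_inside outside_first A B t;
         C = A ** B;
         C_hat = scaled_product (mul \<epsilon>) S
     in \<forall>i j. \<bar>C $ i $ j - C_hat $ i $ j\<bar>
          \<le> c * \<epsilon> * (rscale S $ i * sscale S $ j) * (max_norm (matA S) * max_norm (matB S)))"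
proof -
  obtain c where c: "\<And>\<epsilon> X Y i j. \<epsilon> \<in> {0<..\<epsilon>\<^sub>0} \<Longrightarrow>
      \<bar>(X ** Y) $ i $ j - mul \<epsilon> X Y $ i $ j\<bar> \<le> c * \<epsilon> * max_norm X * max_norm Y"
    using assms unfolding fast_matrix_mult_def by blast
  show ?thesis
    unfolding Let_def
  \<comment> \<open>The constant of the multiplication algorithm itself serves: its bound is uniform
    in the input matrices, hence holds for the scaled ones after any number of steps.\<close>
  proof (intro exI[of _ c] ballI allI impI)
    fix \<epsilon> and A :: "real^'k^'m" and B :: "real^'n^'k" and outside_first t i j
    assume eps: "\<epsilon> \<in> {0<..\<epsilon>\<^sub>0}" and nz: "no_zero_rows_columns A" "no_zero_rows_columns B"
    show "\<bar>(A ** B) $ i $ j - scaled_product (mul \<epsilon>) (outside_inside outside_first A B t) $ i $ j\<bar>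
      \<le> c * \<epsilon> * (rscale (outside_inside outside_first A B t) $ i *
          sscale (outside_inside outside_first A B t) $ j) *
        (max_norm (matA (outside_inside outside_first A B t)) *
          max_norm (matB (outside_inside outside_first A B t)))"
      using scaled_product_error[where mul = "mul \<epsilon>", OF exact_scaling_outside_inside[OF nz] c[OF eps]]
      by (simp add: mult_ac)
  qed
qed

end
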